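(* Let $K\subset L$ be fields and let $T=K+XL[X]$. Let $D$ be a subring of $K$ and let $R=D+XL[X]$. Then $R$ is an HFD if and only if $D$ is a field and $T$ is an HFD.
   Context: All rings are commutative with unity. For $A\subset B$ rings, $A+XB[X]$ denotes the subring of the polynomial ring $B[X]$ consisting of the polynomials whose constant term lies in $A$. An integral domain is atomic if every nonzero noninvertible element is a product of irreducible elements. An integral domain is a half-factorial domain (HFD) if it is atomic and, for each nonzero nonunit, all factorizations of that element into products of irreducible elements have the same length. *)

theory Defs
  imports "HOL-Algebra.Algebra"
begin

text \<open>
  The locales are modelled on \<^locale>\<open>factorial_domain\<close>: factorizations are finite lists of
  irreducible elements of the multiplicative monoid \<^term>\<open>mult_of R\<close> of nonzero elements, with
  product equal to (not merely associated to) the given element.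
\<close>

locale atomic_domain = domain +
  assumes irreducible_factors_exist:
    "\<lbrakk>a \<in> carrier R; a \<noteq> \<zero>; a \<notin> Units R\<rbrakk>
      \<Longrightarrow> \<exists>fs. set fs \<subseteq> carrier (mult_of R) \<and> factors (mult_of R) fs a"

locale half_factorial_domain = atomic_domain +
  assumes factors_length_unique:
    "\<lbrakk>a \<in> carrier R; a \<noteq> \<zero>; a \<notin> Units R;
      set fs \<subseteq> carrier (mult_of R); factors (mult_of R) fs a;
      set gs \<subseteq> carrier (mult_of R); factors (mult_of R) gs a\<rbrakk>
      \<Longrightarrow> length fs = length gs"

text \<open>\<open>const_term_subring B A\<close> is $A + X B[X]$, as a ring in its own right.\<close>

definition const_term_subring :: "('a, 'b) ring_scheme \<Rightarrow> 'a set \<Rightarrow> 'a list ring"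
  where "const_term_subring B A =
    (univ_poly B (carrier B))
      \<lparr>carrier := {p \<in> carrier (univ_poly B (carrier B)). ring.const_term B p \<in> A}\<rparr>"

lemma (in domain) const_term_subring_is_subring:
  assumes "subring A R"
  shows "subring (carrier (const_term_subring R A)) (univ_poly R (carrier R))"
proof -
  interpret P: domain "univ_poly R (carrier R)"
    by (rule univ_poly_is_domain[OF carrier_is_subring])
  note ct = const_term_simprules_shell[OF carrier_is_subring]
  have one: "const_term \<one>\<^bsub>univ_poly R (carrier R)\<^esub> = \<one>"
    by (simp add: univ_poly_one const_term_def)
  show ?thesis
    unfolding const_term_subring_def
    by (rule P.subringI)
      (auto simp: ct one subringE(3,5,6,7)[OF assms])
qed

end

(* A constant of K is a unit, so a nontrivial factorization p = q r in L[X] of an element of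
   K + X L[X] can be rescaled by a constant of L to one inside K + X L[X].  Hence for every
   subfield K the irreducible elements of K + X L[X] are irreducible in L[X], and K + X L[X] is
   an HFD because L[X] is factorial.  Conversely, if d is a nonzero nonunit of D, no p with zero
   constant term is irreducible in D + X L[X], since p = d (p / d); so X has no factorization
   into irreducibles. *)

theory Submission
  imports Defs
begin

section \<open>Carrier and operations of A + X B[X], and lengths of factorizations\<close>

lemma carrier_const_term_subring:
  "carrier (const_term_subring R A) =
    {p \<in> carrier (univ_poly R (carrier R)). ring.const_term R p \<in> A}"
  by (simp add: const_term_subring_def)

lemma const_term_subring_simps [simp]:
  "(\<otimes>\<^bsub>const_term_subring R A\<^esub>) = (\<otimes>\<^bsub>univ_poly R (carrier R)\<^esub>)"
  "\<one>\<^bsub>const_term_subring R A\<^esub> = \<one>\<^bsub>univ_poly R (carrier R)\<^esub>"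
  "\<zero>\<^bsub>const_term_subring R A\<^esub> = \<zero>\<^bsub>univ_poly R (carrier R)\<^esub>"
  by (simp_all add: const_term_subring_def)

text \<open>Unique factorization is up to a permutation and associates, and both preserve the length
  of the list.\<close>

lemma (in factorial_monoid) factors_length_eq:
  assumes "factors G fs a" "factors G gs a" "a \<in> carrier G" "a \<notin> Units G"
    and "set fs \<subseteq> carrier G" "set gs \<subseteq> carrier G"
  shows "length fs = length gs"
  using factors_unique[OF assms] unfolding essentially_equal_def
  by (metis list_all2_lengthD mset_eq_length)

section \<open>Constant terms over a domain\<close>

context domain
begin

abbreviation (input) P where "P \<equiv> univ_poly R (carrier R)"

lemma const_term_subring_is_domain:
  assumes "subring A R"
  shows "domain (const_term_subring R A)"
proof -
  have "const_term_subring R A =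
    P\<lparr>carrier := carrier (const_term_subring R A)\<rparr>"
    by (simp add: const_term_subring_def)
  then show ?thesis
    using domain.subring_is_domain[OF univ_poly_is_domain[OF carrier_is_subring]
        const_term_subring_is_subring[OF assms]] by simp
qed

lemma const_term_const [simp]: "a \<in> carrier R \<Longrightarrow> const_term [a] = a"
  by (simp add: const_term_def)

lemma const_term_one: "const_term \<one>\<^bsub>P\<^esub> = \<one>"
  by (simp add: univ_poly_one)

lemma const_poly_closed:
  "a \<in> carrier R \<Longrightarrow> a \<noteq> \<zero> \<Longrightarrow> [a] \<in> carrier P"
  by (simp add: univ_poly_def polynomial_def)

lemma degree_univ_poly_mult:
  assumes "p \<in> carrier P" "q \<in> carrier P"
    and "p \<noteq> []" "q \<noteq> []"
  shows "degree (p \<otimes>\<^bsub>P\<^esub> q) = degree p + degree q"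
  using poly_mult_degree_eq[OF carrier_is_subring, of p q] assms
  by (simp add: univ_poly_carrier univ_poly_mult)

text \<open>Taking constant terms is multiplicative, preserves one and maps A + X B[X] into A, so it
  carries inverses to inverses.\<close>

lemma const_term_Units:
  assumes "p \<in> Units (const_term_subring R A)"
  shows "const_term p \<in> Units (R\<lparr>carrier := A\<rparr>)"
proof -
  note ct = const_term_simprules_shell[OF carrier_is_subring]
  from assms obtain q where
    pq: "p \<in> carrier (const_term_subring R A)" "q \<in> carrier (const_term_subring R A)"
    "q \<otimes>\<^bsub>P\<^esub> p = \<one>\<^bsub>P\<^esub>"
    "p \<otimes>\<^bsub>P\<^esub> q = \<one>\<^bsub>P\<^esub>"
    by (auto simp: Units_def)
  then have "const_term q \<otimes> const_term p = \<one>" "const_term p \<otimes> const_term q = \<one>"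
    using ct(2)[of q p] ct(2)[of p q] const_term_one
    by (auto simp: carrier_const_term_subring)
  with pq show ?thesis
    by (auto simp: Units_def carrier_const_term_subring)
qed

text \<open>Constant terms multiply in a domain, and the empty product has constant term one, which
  is nonzero.\<close>

lemma const_term_prod_zeroD:
  assumes "set fs \<subseteq> carrier P"
    and "const_term
      (foldr (\<otimes>\<^bsub>P\<^esub>) fs \<one>\<^bsub>P\<^esub>) = \<zero>"
  shows "\<exists>f\<in>set fs. const_term f = \<zero>"
proof -
  interpret P: domain P
    by (rule univ_poly_is_domain[OF carrier_is_subring])
  note ct = const_term_simprules_shell[OF carrier_is_subring]
  show ?thesis
    using assms
  proof (induction fs)
    case Nil
    then show ?case by (simp add: const_term_one)
  next
    case (Cons f fs)
    let ?g = "foldr (\<otimes>\<^bsub>P\<^esub>) fs \<one>\<^bsub>P\<^esub>"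
    have "set fs \<subseteq> carrier P \<Longrightarrow> ?g \<in> carrier P"
      by (induction fs) auto
    with Cons.prems have f: "f \<in> carrier P"
      and g: "?g \<in> carrier P"
      and "const_term f \<otimes> const_term ?g = \<zero>"
      by (auto simp: ct(2))
    then have "const_term f = \<zero> \<or> const_term ?g = \<zero>"
      using ct(1) integral by blast
    with Cons show ?case by auto
  qed
qed

end

section \<open>Polynomials over a field: units, factorizations, and constant terms in a subfield or
  a subring\<close>

context field
begin

lemma const_polys_mult_inv:
  assumes "a \<in> carrier R" "a \<noteq> \<zero>"
  shows "[a] \<otimes>\<^bsub>P\<^esub> [inv a] = \<one>\<^bsub>P\<^esub>" "inv a \<in> carrier R" "inv a \<noteq> \<zero>"
proof -
  show "inv a \<in> carrier R" "inv a \<noteq> \<zero>"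
    using subfield_m_inv(1)[OF carrier_is_subfield] assms by auto
  then show "[a] \<otimes>\<^bsub>P\<^esub> [inv a] = \<one>\<^bsub>P\<^esub>"
    using subfield_m_inv(2)[OF carrier_is_subfield] assms
    by (simp add: univ_poly_mult univ_poly_one)
qed

text \<open>A nonzero constant in \<open>K\<close> has its inverse in \<open>K\<close>. The
  condition \<open>p \<noteq> []\<close> excludes the zero polynomial, whose degree is also 0 by
  convention.\<close>

lemma Units_const_term_subring:
  assumes "subfield K R"
  shows "p \<in> Units (const_term_subring R K) \<longleftrightarrow>
    p \<in> carrier (const_term_subring R K) \<and> p \<noteq> [] \<and> degree p = 0"
proof
  assume p: "p \<in> Units (const_term_subring R K)"
  then have "p \<in> carrier (const_term_subring R K)" "p \<in> Units P"
    by (auto simp: Units_def carrier_const_term_subring)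
  then show "p \<in> carrier (const_term_subring R K) \<and> p \<noteq> [] \<and> degree p = 0"
    using univ_poly_units'[OF carrier_is_subfield, of p] by blast
next
  assume p: "p \<in> carrier (const_term_subring R K) \<and> p \<noteq> [] \<and> degree p = 0"
  then have "p \<in> Units P"
    using univ_poly_units'[OF carrier_is_subfield, of p]
    by (simp add: carrier_const_term_subring)
  then obtain k where k: "p = [k]" "k \<in> carrier R" "k \<noteq> \<zero>"
    by (auto simp: univ_poly_carrier_units)
  with p have "k \<in> K" by (simp add: carrier_const_term_subring)
  then have "inv k \<in> K"
    using subfield_m_inv(1)[OF assms] k by blast
  \<comment> \<open>The inverse of \<open>inv k\<close> is \<open>k\<close>, so the one-sided law at
    \<open>inv k\<close> gives the product in the other order.\<close>
  moreover have "[inv k] \<otimes>\<^bsub>P\<^esub> [k] = \<one>\<^bsub>P\<^esub>"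
    using const_polys_mult_inv(1)[of "inv k"] const_polys_mult_inv(2,3)[OF k(2,3)] k
    by (simp add: field_Units)
  ultimately show "p \<in> Units (const_term_subring R K)"
    using const_polys_mult_inv[OF k(2,3)] const_poly_closed[of "inv k"] p k(1,2)
    by (auto simp: Units_def carrier_const_term_subring intro!: bexI[of _ "[inv k]"])
qed

text \<open>Multiplying one factor by the constant \<open>c\<close> and the other by its inverse
  gives control over the constant terms.\<close>

lemma rescale_factorization:
  assumes "q \<in> carrier P" "r \<in> carrier P" "c \<in> carrier R" "c \<noteq> \<zero>" "q \<noteq> []" "r \<noteq> []"
  obtains q' r' where "q' \<in> carrier P" "r' \<in> carrier P"
    "q' \<otimes>\<^bsub>P\<^esub> r' = q \<otimes>\<^bsub>P\<^esub> r"
    "degree q' = degree q" "degree r' = degree r"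
    "const_term q' = c \<otimes> const_term q" "const_term r' = inv c \<otimes> const_term r"
proof -
  interpret P: domain P by (rule univ_poly_is_domain[OF carrier_is_subring])
  note c = const_polys_mult_inv[OF assms(3,4)]
  note cl = const_poly_closed[OF assms(3,4)] const_poly_closed[OF c(2,3)]
  note ct = const_term_simprules_shell[OF carrier_is_subring]
  show thesis
  proof (rule that[of "[c] \<otimes>\<^bsub>P\<^esub> q" "[inv c] \<otimes>\<^bsub>P\<^esub> r"])
    have "([c] \<otimes>\<^bsub>P\<^esub> q) \<otimes>\<^bsub>P\<^esub> ([inv c] \<otimes>\<^bsub>P\<^esub> r)
      = ([c] \<otimes>\<^bsub>P\<^esub> [inv c]) \<otimes>\<^bsub>P\<^esub> (q \<otimes>\<^bsub>P\<^esub> r)"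
      using cl assms(1,2) by (simp add: P.m_ac)
    then show "([c] \<otimes>\<^bsub>P\<^esub> q) \<otimes>\<^bsub>P\<^esub> ([inv c] \<otimes>\<^bsub>P\<^esub> r) = q \<otimes>\<^bsub>P\<^esub> r"
      using assms(1,2) by (simp add: c)
    show "degree ([c] \<otimes>\<^bsub>P\<^esub> q) = degree q" "degree ([inv c] \<otimes>\<^bsub>P\<^esub> r) = degree r"
      using degree_univ_poly_mult[OF cl(1) assms(1)] degree_univ_poly_mult[OF cl(2) assms(2)]
        assms(5,6) by simp_all
  qed (use assms c cl in \<open>simp_all add: ct\<close>)
qed

text \<open>Only the product of the two constant terms is known to lie in \<open>K\<close>; a
  rescaling, chosen according to which of them vanish, brings each one into
  \<open>K\<close>.\<close>

lemma factorization_in_const_term_subring: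
  assumes K: "subfield K R" and p: "p \<in> carrier (const_term_subring R K)"
    and qr: "q \<in> carrier P" "r \<in> carrier P" "p = q \<otimes>\<^bsub>P\<^esub> r" and ne: "q \<noteq> []" "r \<noteq> []"
  obtains q' r' where "q' \<in> carrier (const_term_subring R K)"
    "r' \<in> carrier (const_term_subring R K)" "p = q' \<otimes>\<^bsub>P\<^esub> r'"
    "degree q' = degree q" "degree r' = degree r"
proof -
  note ct = const_term_simprules_shell[OF carrier_is_subring]
  note K_subring = subfieldE(1)[OF K]
  let ?a = "const_term q" and ?b = "const_term r"
  have ab: "?a \<in> carrier R" "?b \<in> carrier R" "?a \<otimes> ?b \<in> K"
    using qr p by (auto simp: ct carrier_const_term_subring)
  show thesis
  proof (cases "?a = \<zero>")
    case a: False
    \<comment> \<open>Rescaling by \<open>inv ?a\<close> turns the constant terms into 1 and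
      \<open>?a \<otimes> ?b\<close>.\<close>
    note inv_a = const_polys_mult_inv(2,3)[OF ab(1) a]
    obtain q' r' where qr': "q' \<in> carrier P" "r' \<in> carrier P" "q' \<otimes>\<^bsub>P\<^esub> r' = q \<otimes>\<^bsub>P\<^esub> r"
      "degree q' = degree q" "degree r' = degree r"
      "const_term q' = inv ?a \<otimes> ?a" "const_term r' = inv (inv ?a) \<otimes> ?b"
      using rescale_factorization[OF qr(1,2) inv_a ne] .
    have "const_term q' = \<one>" "const_term r' = ?a \<otimes> ?b"
      using qr'(6,7) ab(1) a by (simp_all add: field_Units)
    then show thesis
      using qr' ab(3) subringE(3)[OF K_subring] qr(3)
      by (intro that[of q' r']) (simp_all add: carrier_const_term_subring)
  next
    case a: True
    show thesis
    proof (cases "?b = \<zero>")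
      case b: False
      \<comment> \<open>Rescaling by \<open>?b\<close> turns the constant terms 0 and
        \<open>?b\<close> into 0 and 1.\<close>
      obtain q' r' where qr': "q' \<in> carrier P" "r' \<in> carrier P" "q' \<otimes>\<^bsub>P\<^esub> r' = q \<otimes>\<^bsub>P\<^esub> r"
        "degree q' = degree q" "degree r' = degree r"
        "const_term q' = ?b \<otimes> ?a" "const_term r' = inv ?b \<otimes> ?b"
        using rescale_factorization[OF qr(1,2) ab(2) b ne] .
      have "const_term q' = \<zero>" "const_term r' = \<one>"
        using qr'(6,7) ab a b by (simp_all add: field_Units)
      then show thesis
        using qr' subringE(2,3)[OF K_subring] qr(3)
        by (intro that[of q' r']) (simp_all add: carrier_const_term_subring)
    next
      case True
      with a show thesis
        using that[of q r] qr subringE(2)[OF K_subring]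
        by (simp add: carrier_const_term_subring)
    qed
  qed
qed

text \<open>A factorization in L[X] moves into K + X L[X] with the same degrees. There one factor is
  a unit, hence of degree 0, so the corresponding original factor is a nonzero constant.\<close>

lemma irreducible_const_term_subring_imp_irreducible:
  assumes K: "subfield K R" and p: "p \<in> carrier (const_term_subring R K)" "p \<noteq> []"
    and irr: "irreducible (mult_of (const_term_subring R K)) p"
  shows "irreducible (mult_of P) p"
proof -
  interpret T: domain "const_term_subring R K"
    by (rule const_term_subring_is_domain[OF subfieldE(1)[OF K]])
  interpret P: domain P by (rule univ_poly_is_domain[OF carrier_is_subring])
  have ring_irr: "ring_irreducible\<^bsub>const_term_subring R K\<^esub> p"
    using T.ring_irreducibleI' p irr by (simp add: univ_poly_zero)
  note irrE = T.ring_irreducibleE[OF p(1) ring_irr]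
  have pP: "p \<in> carrier P" using p by (simp add: carrier_const_term_subring)
  have "ring_irreducible\<^bsub>P\<^esub> p"
  proof (rule P.ring_irreducibleI)
    show "p \<in> carrier P - {\<zero>\<^bsub>P\<^esub>}" using p pP by (simp add: univ_poly_zero)
    \<comment> \<open>For an element of K + X L[X], being a unit in either ring means being a
      nonzero constant.\<close>
    show "p \<notin> Units P"
      using irrE(4) p pP univ_poly_units'[OF carrier_is_subfield, of p]
        Units_const_term_subring[OF K, of p] by blast
  next
    fix q r assume qr: "q \<in> carrier P" "r \<in> carrier P" "p = q \<otimes>\<^bsub>P\<^esub> r"
    then have ne: "q \<noteq> []" "r \<noteq> []"
      using p P.l_null P.r_null by (auto simp: univ_poly_zero)
    obtain q' r' where qr': "q' \<in> carrier (const_term_subring R K)"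
      "r' \<in> carrier (const_term_subring R K)" "p = q' \<otimes>\<^bsub>P\<^esub> r'"
      "degree q' = degree q" "degree r' = degree r"
      using factorization_in_const_term_subring[OF K p(1) qr ne] .
    then have "degree q = 0 \<or> degree r = 0"
      using irrE(5)[OF qr'(1,2)] Units_const_term_subring[OF K] by auto
    then show "q \<in> Units P \<or> r \<in> Units P"
      using univ_poly_units'[OF carrier_is_subfield] qr ne by blast
  qed
  then show ?thesis
    using P.ring_irreducibleE(3)[OF pP] by simp
qed

text \<open>Nonzero nonunits have positive degree, so splitting into two nonunits lowers the degree
  strictly and induction on the degree applies.\<close>

lemma const_term_subring_atomic:
  assumes K: "subfield K R"
    and "p \<in> carrier (const_term_subring R K)" "p \<noteq> []"
    and "p \<notin> Units (const_term_subring R K)"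
  shows "\<exists>fs. set fs \<subseteq> carrier (mult_of (const_term_subring R K)) \<and>
    factors (mult_of (const_term_subring R K)) fs p"
proof -
  let ?T = "const_term_subring R K"
  interpret T: domain ?T
    by (rule const_term_subring_is_domain[OF subfieldE(1)[OF K]])
  show ?thesis
    using assms(2-)
  proof (induction "degree p" arbitrary: p rule: less_induct)
    case less
    show ?case
    proof (cases "ring_irreducible\<^bsub>?T\<^esub> p")
      case True
      \<comment> \<open>The simp rules rewriting the operations of \<open>?T\<close> to those of
        L[X] are removed so that the unit law of \<open>?T\<close> itself can fire.\<close>
      then have "factors (mult_of ?T) [p] p"
        using T.ring_irreducibleE(3)[of p] less.prems
        by (simp add: factors_def del: const_term_subring_simps)
      with less.prems show ?thesis
        by (intro exI[of _ "[p]"]) (simp add: univ_poly_zero)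
    next
      case False
      then obtain q r where qr: "q \<in> carrier ?T" "r \<in> carrier ?T" "p = q \<otimes>\<^bsub>?T\<^esub> r"
        and nu: "q \<notin> Units ?T" "r \<notin> Units ?T"
        using T.ring_irreducibleI[of p] less.prems by (auto simp: univ_poly_zero)
      have ne: "q \<noteq> []" "r \<noteq> []"
        using qr less.prems T.l_null T.r_null by (auto simp: univ_poly_zero)
      have deg: "degree q > 0" "degree r > 0"
        using nu qr(1,2) ne Units_const_term_subring[OF K, of q]
          Units_const_term_subring[OF K, of r] by simp_all
      have "degree p = degree q + degree r"
        using qr ne degree_univ_poly_mult by (simp add: carrier_const_term_subring)
      with deg have "degree q < degree p" "degree r < degree p" by linarith+
      then obtain fs gs where
        "set fs \<subseteq> carrier (mult_of ?T)" "factors (mult_of ?T) fs q"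
        "set gs \<subseteq> carrier (mult_of ?T)" "factors (mult_of ?T) gs r"
        using less.hyps[OF _ qr(1) ne(1) nu(1)] less.hyps[OF _ qr(2) ne(2) nu(2)] by blast
      then show ?thesis
        using T.mult_of.factors_mult[of fs q gs r] qr(3)
        by (intro exI[of _ "fs @ gs"]) simp
    qed
  qed
qed

text \<open>Lengths are compared in L[X], which is a principal ideal domain and hence
  factorial.\<close>

theorem const_term_subring_half_factorial:
  assumes K: "subfield K R"
  shows "half_factorial_domain (const_term_subring R K)"
proof -
  let ?T = "const_term_subring R K"
  interpret T: domain ?T
    by (rule const_term_subring_is_domain[OF subfieldE(1)[OF K]])
  interpret P: principal_domain P
    by (rule univ_poly_is_principal[OF carrier_is_subfield])
  \<comment> \<open>Both rings share multiplication and one, so the product condition carries over;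
    irreducibility of the factors comes from the transfer to L[X].\<close>
  have factors_P: "factors (mult_of P) fs a \<and> set fs \<subseteq> carrier (mult_of P)"
    if "set fs \<subseteq> carrier (mult_of ?T)" "factors (mult_of ?T) fs a" for fs a
    using that irreducible_const_term_subring_imp_irreducible[OF K]
    by (auto simp: factors_def univ_poly_zero carrier_const_term_subring subset_iff)
  show ?thesis
  proof (unfold_locales)
    fix a assume "a \<in> carrier ?T" "a \<noteq> \<zero>\<^bsub>?T\<^esub>" "a \<notin> Units ?T"
    then show "\<exists>fs. set fs \<subseteq> carrier (mult_of ?T) \<and> factors (mult_of ?T) fs a"
      using const_term_subring_atomic[OF K] by (simp add: univ_poly_zero)
  next
    fix a fs gs
    assume a: "a \<in> carrier ?T" "a \<noteq> \<zero>\<^bsub>?T\<^esub>" "a \<notin> Units ?T"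
      and fs: "set fs \<subseteq> carrier (mult_of ?T)" "factors (mult_of ?T) fs a"
      and gs: "set gs \<subseteq> carrier (mult_of ?T)" "factors (mult_of ?T) gs a"
    have aP: "a \<in> carrier (mult_of P)" "a \<notin> Units (mult_of P)"
      using a Units_const_term_subring[OF K, of a]
        univ_poly_units'[OF carrier_is_subfield, of a]
      by (auto simp: univ_poly_zero carrier_const_term_subring)
    show "length fs = length gs"
      using P.mult_of.factors_length_eq aP factors_P[OF fs] factors_P[OF gs] by blast
  qed
qed

text \<open>The argument runs directly: some irreducible factor \<open>f\<close> of \<open>X\<close>
  has constant term zero, and pulling any nonzero constant \<open>d\<close> of \<open>A\<close> out
  of \<open>f\<close> forces \<open>d\<close> to be a unit.\<close>

lemma atomic_const_term_subring_imp_subfield: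
  assumes A: "subring A R" and atomic: "atomic_domain (const_term_subring R A)"
  shows "subfield A R"
proof (rule subfieldI[OF subcringI'[OF A]])
  let ?T = "const_term_subring R A"
  interpret T: atomic_domain ?T by (rule atomic)
  interpret P: domain P by (rule univ_poly_is_domain[OF carrier_is_subring])
  interpret A: domain "R\<lparr>carrier := A\<rparr>" by (rule subring_is_domain[OF A])
  note ct = const_term_simprules_shell[OF carrier_is_subring]
  note A_sub = subringE(1,2)[OF A]
  \<comment> \<open>By \<open>const_term_Units\<close>, this makes every element with constant term
    zero a nonunit; it is applied to \<open>X\<close> and to \<open>?g\<close>.\<close>
  have zero_not_unit: "\<zero> \<notin> Units (R\<lparr>carrier := A\<rparr>)"
    using A.zero_not_one by (auto simp: Units_def dest: subsetD[OF A_sub(1)])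
  \<comment> \<open>The constant term is the value at zero, so evaluating \<open>X\<close> there
    gives 0.\<close>
  have X: "X \<in> carrier P" "const_term X = \<zero>" "X \<noteq> []"
    using var_closed(1)[OF carrier_is_subring] eval_var[OF zero_closed]
    by (simp_all add: const_term_def var_def)
  then have "X \<in> carrier ?T" "X \<noteq> \<zero>\<^bsub>?T\<^esub>" "X \<notin> Units ?T"
    using A_sub const_term_Units[of X A] zero_not_unit
    by (auto simp: carrier_const_term_subring univ_poly_zero)
  then obtain fs where fs: "set fs \<subseteq> carrier (mult_of ?T)" "factors (mult_of ?T) fs X"
    using T.irreducible_factors_exist by blast
  then have "set fs \<subseteq> carrier P"
    by (auto simp: carrier_const_term_subring)
  then obtain f where "f \<in> set fs" and ct_f: "const_term f = \<zero>"
    using const_term_prod_zeroD[of fs] fs X(2) by (auto simp: factors_def)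
  with fs have f: "f \<in> carrier ?T - {\<zero>\<^bsub>?T\<^esub>}" and irr: "irreducible (mult_of ?T) f"
    by (auto simp: factors_def)
  have fP: "f \<in> carrier P" using f by (simp add: carrier_const_term_subring)
  show "Units (R\<lparr>carrier := A\<rparr>) = A - {\<zero>}"
  proof (intro equalityI subsetI)
    fix d assume "d \<in> A - {\<zero>}"
    then have d: "d \<in> carrier R" "d \<noteq> \<zero>" "d \<in> A" using A_sub by auto
    note inv_d = const_polys_mult_inv[OF d(1,2)]
    note cl = const_poly_closed[OF d(1,2)] const_poly_closed[OF inv_d(2,3)]
    let ?g = "[inv d] \<otimes>\<^bsub>P\<^esub> f"
    \<comment> \<open>Although \<open>inv d\<close> may lie outside \<open>A\<close>, the quotient
      \<open>?g\<close> stays in \<open>?T\<close>: only the constant term is constrained, and it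
      remains zero.\<close>
    have "const_term ?g = \<zero>" using ct_f inv_d cl fP by (simp add: ct)
    then have g: "?g \<in> carrier ?T" "?g \<notin> Units ?T"
      using cl fP A_sub const_term_Units[of ?g A] zero_not_unit
      by (auto simp: carrier_const_term_subring)
    have "[d] \<in> carrier ?T" using d cl by (simp add: carrier_const_term_subring)
    moreover have "f = [d] \<otimes>\<^bsub>?T\<^esub> ?g"
      using P.m_assoc[OF cl fP] inv_d(1) P.l_one[OF fP] by simp
    \<comment> \<open>Irreducibility of \<open>f\<close> makes one of the two factors a unit, and
      \<open>?g\<close> is not one.\<close>
    ultimately have "[d] \<in> Units ?T"
      using T.ring_irreducibleE(5)[OF _ T.ring_irreducibleI'[OF f irr]] f g by blast
    then show "d \<in> Units (R\<lparr>carrier := A\<rparr>)"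
      using const_term_Units[of "[d]" A] d by simp
  next
    fix d assume "d \<in> Units (R\<lparr>carrier := A\<rparr>)"
    then show "d \<in> A - {\<zero>}"
      using zero_not_unit A.Units_closed by auto
  qed
qed

end

section \<open>The equivalence for D inside K inside L\<close>

theorem proposition2p4:
  fixes L (structure) and K D :: "'a set"
  assumes "field L"
    and "subfield K L"
    and "subring D (L\<lparr>carrier := K\<rparr>)"
  defines "T \<equiv> const_term_subring L K"
    and "R \<equiv> const_term_subring L D"
  shows "half_factorial_domain R \<longleftrightarrow>
    field (L\<lparr>carrier := D\<rparr>) \<and> half_factorial_domain T"
proof -
  interpret L: field L by fact
  have K: "subring K L" "K \<subseteq> carrier L"
    using subfieldE(1,3)[OF assms(2)] by auto
  have D_K: "D \<subseteq> K"
    using subringE(1)[OF assms(3)] by simp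
  \<comment> \<open>\<open>D\<close> is given as a subring of \<open>K\<close>; passing through its
    own ring structure makes it a subring of \<open>L\<close>.\<close>
  have "ring (L\<lparr>carrier := D\<rparr>)"
    using ring.subring_is_ring[OF L.subring_is_ring[OF K(1)] assms(3)] by simp
  then have D: "subring D L"
    using L.ring_incl_imp_subring D_K K by blast
  have T: "half_factorial_domain T"
    unfolding T_def using L.const_term_subring_half_factorial[OF assms(2)] .
  show ?thesis
  proof
    assume "half_factorial_domain R"
    then have "subfield D L"
      unfolding R_def half_factorial_domain_def
      using L.atomic_const_term_subring_imp_subfield[OF D] by blast
    with T show "field (L\<lparr>carrier := D\<rparr>) \<and> half_factorial_domain T"
      using L.subfield_iff(2) by blast
  next
    assume "field (L\<lparr>carrier := D\<rparr>) \<and> half_factorial_domain T"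
    then have "subfield D L"
      using L.subfield_iff(1) D_K K by blast
    then show "half_factorial_domain R"
      unfolding R_def using L.const_term_subring_half_factorial by blast
  qed
qed

end
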